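(* Let $N\ge5$ be prime, let $\varepsilon\ge0$ and $T>0$ be real numbers. Suppose $\mathbf{H}=\sum_{i=0}^{N^2-1}s_i\mathbf{H}_i\in\mathbb{C}^{N\times N}$, where the coefficient vector $\mathbf{s}=(s_0,\dots,s_{N^2-1})^{\mathrm T}\in\mathbb{C}^{N^2}$ is $K$-sparse with $$K<\frac{\tfrac12(\sqrt N+1)}{1+2\varepsilon N/T}.$$ Suppose further that $\mathbf{y}=\mathbf{H}\mathbf{f}+\mathbf{e}$ is observed, where $\mathbf{f}$ is the Alltop sequence of length $N$ and each entry of the noise $\mathbf{e}\in\mathbb{C}^N$ satisfies $|e_n|\le\varepsilon$. Then any solution $\mathbf{s}^\bigstar$ of the noise-aware Basis Pursuit problem $$\min_{\mathbf{s}'\in\mathbb{C}^{N^2}}\|\mathbf{s}'\|_1\quad\text{subject to}\quad |(\mathbf{\Phi}\mathbf{s}'-\mathbf{y})_n|\le\varepsilon,\quad n=0,\dots,N-1,$$ satisfies $\|\mathbf{s}-\mathbf{s}^\bigstar\|_1\le T$.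
   Context: Indices of coordinates in $\mathbb{C}^N$ run over $0,\dots,N-1$, and $\omega_N=e^{2\pi \mathrm{i}/N}$ with $\mathrm{i}=\sqrt{-1}$. Time-frequency basis: $\mathbf{S}$ is the $N\times N$ cyclic unit-shift matrix, $\mathbf{S}e_j=e_{(j+1)\bmod N}$ on standard basis vectors, and $\mathbf{M}=\mathrm{diag}(\omega_N^0,\omega_N^1,\dots,\omega_N^{N-1})$. For $i=0,\dots,N^2-1$, $\mathbf{H}_i=\mathbf{M}^{\,i \bmod N}\,\mathbf{S}^{\lfloor i/N\rfloor}$. The unitary matrices $\mathbf{H}_i$ form a basis of $\mathbb{C}^{N\times N}$, orthogonal for the Frobenius inner product. Alltop sequence: $\mathbf{f}=(f_n)_{n=0}^{N-1}$ with $f_n=\frac{1}{\sqrt N}e^{2\pi \mathrm{i} n^3/N}$. Dictionary: $\mathbf{\Phi}\in\mathbb{C}^{N\times N^2}$ is the matrix with columns $\boldsymbol{\varphi}_i=\mathbf{H}_i\mathbf{f}$, $i=0,\dots,N^2-1$, so that $\mathbf{H}\mathbf{f}=\mathbf{\Phi}\mathbf{s}$. A vector is $K$-sparse if at most $K$ of its entries are nonzero. $\|\mathbf{s}'\|_1=\sum_i|s'_i|$. *)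

theory Defs
  imports
    Complex_Main
    "HOL-Computational_Algebra.Primes"
    "Jordan_Normal_Form.Matrix"
begin

definition omega :: "nat \<Rightarrow> complex" where
  "omega N = exp (2 * of_real pi * \<i> / of_nat N)"

(* Column j is the standard basis vector with index (j + 1) mod N. *)
definition shift_mat :: "nat \<Rightarrow> complex mat" where
  "shift_mat N = mat N N (\<lambda>(k, j). if k = (j + 1) mod N then 1 else 0)"

definition modulation_mat :: "nat \<Rightarrow> complex mat" where
  "modulation_mat N = mat_diag N (\<lambda>j. omega N ^ j)"

definition tf_mat :: "nat \<Rightarrow> nat \<Rightarrow> complex mat" where
  "tf_mat N i = modulation_mat N ^\<^sub>m (i mod N) * shift_mat N ^\<^sub>m (i div N)"

(* The sum is taken in the module of N x N matrices: the type of matrices of all sizes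
   is not an additive monoid, so the type-class sum is unavailable. *)
definition tf_combination :: "nat \<Rightarrow> complex vec \<Rightarrow> complex mat" where
  "tf_combination N s =
     (\<Oplus>\<^bsub>module_mat TYPE(complex) N N\<^esub> i \<in> {..<N\<^sup>2}. (s $ i) \<cdot>\<^sub>m tf_mat N i)"

definition alltop :: "nat \<Rightarrow> complex vec" where
  "alltop N =
     vec N (\<lambda>n. of_real (1 / sqrt (real N)) * exp (2 * of_real pi * \<i> * of_nat (n ^ 3) / of_nat N))"

definition dictionary :: "nat \<Rightarrow> complex mat" where
  "dictionary N = mat_of_cols N (map (\<lambda>i. tf_mat N i *\<^sub>v alltop N) [0..<N\<^sup>2])"

definition sparse :: "nat \<Rightarrow> complex vec \<Rightarrow> bool" where
  "sparse K s \<longleftrightarrow> card {i. i < dim_vec s \<and> s $ i \<noteq> 0} \<le> K"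

definition l1_norm :: "complex vec \<Rightarrow> real" where
  "l1_norm s = (\<Sum>i<dim_vec s. cmod (s $ i))"

definition bp_feasible :: "complex mat \<Rightarrow> complex vec \<Rightarrow> real \<Rightarrow> complex vec \<Rightarrow> bool" where
  "bp_feasible A y \<epsilon> s \<longleftrightarrow>
     s \<in> carrier_vec (dim_col A) \<and> (\<forall>n<dim_row A. cmod ((A *\<^sub>v s - y) $ n) \<le> \<epsilon>)"

definition bp_solution :: "complex mat \<Rightarrow> complex vec \<Rightarrow> real \<Rightarrow> complex vec \<Rightarrow> bool" where
  "bp_solution A y \<epsilon> s \<longleftrightarrow> is_arg_min l1_norm (bp_feasible A y \<epsilon>) s"

end

theory Submission
  imports Defs
begin

text \<open>The dictionary columns are unit vectors, and the inner product of two of them is, up to the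
  factor \<open>1 / N\<close>, a sum of \<open>N\<close>-th roots of unity whose exponent is a difference of shifted cubes plus
  a linear term, hence a polynomial of degree at most two. For \<open>N \<ge> 5\<close> prime this is a linear
  character sum, which vanishes, or a nondegenerate quadratic Gauss sum of modulus \<open>sqrt N\<close>; so the
  coherence is at most \<open>1 / sqrt N\<close>.

  Let \<open>h = s - s_star\<close>. Pairing \<open>\<Phi> h\<close>, whose entries are at most \<open>2 \<epsilon>\<close>, with a single column gives
  \<open>(sqrt N + 1) |h_i| \<le> 2 \<epsilon> N + \<parallel>h\<parallel>\<close> in the 1-norm. Summing over the support of \<open>s\<close>, which carries at
  least half of \<open>\<parallel>h\<parallel>\<close> by minimality of \<open>s_star\<close>, yields
  \<open>((sqrt N + 1) / 2 - K) \<parallel>h\<parallel> \<le> 2 \<epsilon> N K\<close>, and the sparsity hypothesis says that the factor on the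
  left exceeds \<open>2 \<epsilon> N K / T\<close>.\<close>

section \<open>Additive characters modulo \<open>N\<close> and their complete sums\<close>

definition chi :: "nat \<Rightarrow> int \<Rightarrow> complex" where
  "chi N k = cis (2 * pi * of_int k / of_nat N)"

lemma chi_0 [simp]: "chi N 0 = 1"
  by (simp add: chi_def)

lemma chi_add: "chi N (x + y) = chi N x * chi N y"
  by (simp add: chi_def cis_mult add_divide_distrib distrib_left)

lemma chi_uminus: "chi N (- x) = cnj (chi N x)"
  by (simp add: chi_def cis_cnj)

lemma chi_diff: "chi N (x - y) = chi N x * cnj (chi N y)"
  using chi_add[of N x "- y"] by (simp add: chi_uminus)

lemma chi_power: "chi N x ^ k = chi N (int k * x)"
  by (induction k) (simp_all add: chi_add distrib_right)

lemma norm_chi [simp]: "cmod (chi N x) = 1"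
  by (simp add: chi_def)

lemma chi_eq_1_iff:
  assumes "N > 0"
  shows "chi N k = 1 \<longleftrightarrow> int N dvd k"
proof
  assume "chi N k = 1"
  then have "cos (2 * pi * of_int k / of_nat N) = 1"
    by (metis chi_def cis.sel(1) one_complex.sel(1))
  then obtain n :: int where "2 * pi * of_int k / of_nat N = of_int n * 2 * pi"
    using cos_one_2pi_int by blast
  then have "real_of_int k = of_int (n * int N)"
    using assms by (simp add: field_simps)
  then show "int N dvd k"
    by (metis of_int_eq_iff dvd_triv_right)
next
  assume "int N dvd k"
  then obtain n where "k = int N * n" ..
  then have "2 * pi * of_int k / of_nat N = 2 * pi * of_int n"
    using assms by simp
  then show "chi N k = 1"
    by (simp add: chi_def)
qed

lemma chi_cong:
  assumes "N > 0" and "int N dvd x - y"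
  shows "chi N x = chi N y"
  using chi_add[of N "x - y" y] chi_eq_1_iff[of N "x - y"] assms by simp

text \<open>Raising \<open>d\<close> by one drops the term \<open>F (int d)\<close> and adds
  \<open>F (int N + int d)\<close>, which periodicity makes equal.\<close>

lemma sum_shift_periodic:
  fixes F :: "int \<Rightarrow> 'a::ab_group_add"
  assumes "\<And>m. F (m + int N) = F m"
  shows "(\<Sum>n<N. F (int n + int d)) = (\<Sum>n<N. F (int n))"
proof (induction d)
  case (Suc d)
  let ?G = "\<lambda>n. F (int n + int d)"
  have "?G 0 + (\<Sum>n<N. ?G (Suc n)) = (\<Sum>n<N. ?G n) + ?G N"
    using sum.lessThan_Suc_shift[of ?G N] sum.lessThan_Suc[of ?G N] by simp
  moreover have "?G N = ?G 0"
    using assms[of "int d"] by (simp add: add.commute)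
  ultimately have "(\<Sum>n<N. ?G (Suc n)) = (\<Sum>n<N. ?G n)"
    by simp
  then show ?case
    using Suc by (simp add: algebra_simps)
qed simp

text \<open>Unless all terms are 1, passing from \<open>n\<close> to \<open>n + 1\<close> permutes
  the residues yet multiplies the sum by \<open>chi N c\<close>, which is not 1; so the sum is
  zero.\<close>

lemma sum_chi_mult:
  assumes "N > 0"
  shows "(\<Sum>n<N. chi N (c * int n)) = (if int N dvd c then of_nat N else 0)"
proof (cases "int N dvd c")
  case True
  then have "chi N (c * int n) = 1" for n
    using assms chi_eq_1_iff by simp
  with True show ?thesis by simp
next
  case False
  have "(\<Sum>n<N. chi N (c * (int n + int 1))) = (\<Sum>n<N. chi N (c * int n))"
    by (rule sum_shift_periodic) (use assms in \<open>auto intro!: chi_cong simp: algebra_simps\<close>)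
  then have "chi N c * (\<Sum>n<N. chi N (c * int n)) = (\<Sum>n<N. chi N (c * int n))"
    by (simp add: distrib_left chi_add sum_distrib_left mult.commute)
  moreover have "chi N c \<noteq> 1"
    using False assms chi_eq_1_iff by simp
  ultimately show ?thesis
    using False by simp
qed

text \<open>The hypothesis on the increments of \<open>p\<close> says that \<open>p\<close> is quadratic. Substituting
  \<open>n = m + d\<close> in the double sum for the squared modulus leaves complete linear character sums
  over \<open>m\<close>, of which only the one for \<open>d = 0\<close> survives.\<close>

lemma norm_quadratic_gauss_sum:
  fixes p g :: "int \<Rightarrow> int"
  assumes N: "prime N" and c: "\<not> int N dvd c"
    and periodic: "\<And>m. int N dvd p (m + int N) - p m"
    and increment: "\<And>m d. p (m + d) - p m = g d + c * d * m"
  shows "cmod (\<Sum>n<N. chi N (p (int n))) = sqrt N"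
proof -
  have N0: "N > 0"
    using N prime_gt_0_nat by blast
  let ?F = "\<lambda>m. chi N (p m)"
  have per: "?F (m + int N) = ?F m" for m
    using chi_cong[OF N0 periodic] .
  \<comment> \<open>Primality makes \<open>c\<close> invertible modulo \<open>N\<close>, so the
    linear sum over \<open>m\<close> survives for \<open>d = 0\<close> only.\<close>
  have dvd: "int N dvd c * int d \<longleftrightarrow> d = 0" if "d < N" for d
  proof -
    have "int N dvd c * int d \<longleftrightarrow> int N dvd int d"
      using N c by (simp add: prime_dvd_mult_iff)
    also have "\<dots> \<longleftrightarrow> d = 0"
      using that by (auto dest: dvd_imp_le)
    finally show ?thesis .
  qed
  have "complex_of_real ((cmod (\<Sum>n<N. ?F (int n)))\<^sup>2)
      = (\<Sum>n<N. ?F (int n)) * cnj (\<Sum>m<N. ?F (int m))"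
    by (rule complex_norm_square)
  also have "\<dots> = (\<Sum>m<N. (\<Sum>n<N. ?F (int n)) * cnj (?F (int m)))"
    by (simp add: sum_distrib_left)
  also have "\<dots> = (\<Sum>m<N. (\<Sum>d<N. ?F (int d + int m)) * cnj (?F (int m)))"
    using sum_shift_periodic[of ?F, OF per] by simp
  also have "\<dots> = (\<Sum>m<N. \<Sum>d<N. chi N (g (int d)) * chi N (c * int d * int m))"
    by (simp add: sum_distrib_right chi_diff[symmetric] chi_add[symmetric] increment[symmetric]
        add.commute)
  also have "\<dots> = (\<Sum>d<N. chi N (g (int d)) * (\<Sum>m<N. chi N (c * int d * int m)))"
    by (subst sum.swap) (simp add: sum_distrib_left)
  also have "\<dots> = (\<Sum>d<N. if d = 0 then chi N (g 0) * of_nat N else 0)"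
    by (rule sum.cong) (auto simp: sum_chi_mult[OF N0] dvd)
  also have "\<dots> = chi N (g 0) * of_nat N"
    using N0 by simp
  also have "g 0 = 0"
    using increment[of 0 0] by simp
  finally have "complex_of_real ((cmod (\<Sum>n<N. ?F (int n)))\<^sup>2) = of_real (real N)"
    by simp
  then have "(cmod (\<Sum>n<N. ?F (int n)))\<^sup>2 = real N"
    using of_real_eq_iff by blast
  then show ?thesis
    by (metis real_sqrt_unique norm_ge_zero)
qed

section \<open>Inner products of dictionary columns\<close>

text \<open>Entry \<open>n\<close> of column \<open>i\<close> of the dictionary. The cube is taken of the unreduced integer
  \<open>n - i div N\<close>, so that exponents are polynomial in \<open>n\<close>.\<close>

definition atom :: "nat \<Rightarrow> nat \<Rightarrow> nat \<Rightarrow> complex" where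
  "atom N i n = of_real (1 / sqrt N) *
     chi N (int (i mod N) * int n + (int n - int (i div N)) ^ 3)"

lemma norm_atom: "cmod (atom N i n) = 1 / sqrt N"
  by (simp add: atom_def norm_mult norm_divide)

lemma cnj_atom_mult_atom:
  "cnj (atom N i n) * atom N j n = of_real (1 / N) *
     chi N ((int (j mod N) - int (i mod N)) * int n
       + ((int n - int (j div N)) ^ 3 - (int n - int (i div N)) ^ 3))"
proof -
  have sq: "complex_of_real (1 / sqrt N) * of_real (1 / sqrt N) = of_real (1 / N)"
    by (simp flip: of_real_mult)
  let ?e = "\<lambda>i. int (i mod N) * int n + (int n - int (i div N)) ^ 3"
  have "cnj (atom N i n) * atom N j n =
      (complex_of_real (1 / sqrt N) * of_real (1 / sqrt N)) * (chi N (?e j) * cnj (chi N (?e i)))"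
    by (simp add: atom_def)
  also have "chi N (?e j) * cnj (chi N (?e i)) = chi N (?e j - ?e i)"
    by (simp add: chi_diff)
  also have "?e j - ?e i = (int (j mod N) - int (i mod N)) * int n
       + ((int n - int (j div N)) ^ 3 - (int n - int (i div N)) ^ 3)"
    by (simp add: algebra_simps)
  finally show ?thesis
    unfolding sq .
qed

lemma atom_inner_self:
  assumes "N > 0"
  shows "(\<Sum>n<N. cnj (atom N i n) * atom N i n) = 1"
  using assms by (simp add: cnj_atom_mult_atom)

lemma not_dvd_diff_less:
  assumes "a < N" "b < N" "a \<noteq> b"
  shows "\<not> int N dvd int a - int b"
  using assms by (metis mod_eq_dvd_iff mod_less of_nat_eq_iff zmod_int)

lemma prime_not_dvd_6:
  fixes N :: nat
  assumes "prime N" "N \<ge> 5"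
  shows "\<not> int N dvd 6"
proof
  assume "int N dvd 6"
  then have "N dvd 2 * 3"
    using int_dvd_int_iff[of N 6] by simp
  then have "N dvd 2 \<or> N dvd 3"
    using assms(1) prime_dvd_mult_iff by blast
  then show False
    using assms(2) by (auto dest: dvd_imp_le)
qed

lemma atom_coherence:
  assumes N: "prime N" "N \<ge> 5" and ij: "i < N\<^sup>2" "j < N\<^sup>2" "i \<noteq> j"
  shows "cmod (\<Sum>n<N. cnj (atom N i n) * atom N j n) \<le> 1 / sqrt N"
proof -
  have N0: "N > 0"
    using N(2) by simp
  define \<alpha> where "\<alpha> = int (j mod N) - int (i mod N)"
  define a where "a = int (i div N)"
  define b where "b = int (j div N)"
  define p where "p n = \<alpha> * n + ((n - b) ^ 3 - (n - a) ^ 3)" for n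
  have div: "i div N < N" "j div N < N"
    using ij by (auto simp: power2_eq_square less_mult_imp_div_less)
  have inner: "(\<Sum>n<N. cnj (atom N i n) * atom N j n) = of_real (1 / N) * (\<Sum>n<N. chi N (p (int n)))"
    by (simp add: cnj_atom_mult_atom p_def \<alpha>_def a_def b_def sum_distrib_left)
  show ?thesis
  proof (cases "i div N = j div N")
    \<comment> \<open>For equal shifts the cubes cancel entirely and leave a linear sum whose slope
      is nonzero modulo \<open>N\<close>.\<close>
    case True
    then have "i mod N \<noteq> j mod N"
      using ij(3) by (metis div_mult_mod_eq)
    then have "\<not> int N dvd \<alpha>"
      unfolding \<alpha>_def using N0 by (intro not_dvd_diff_less) auto
    moreover have "p = (\<lambda>n. \<alpha> * n)"
      using True by (simp add: p_def a_def b_def fun_eq_iff)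
    ultimately show ?thesis
      using sum_chi_mult[OF N0, of \<alpha>] by (simp add: inner)
  next
    case False
    then have "\<not> int N dvd a - b"
      unfolding a_def b_def using div by (intro not_dvd_diff_less) auto
    \<comment> \<open>The quadratic coefficient of \<open>p\<close> is \<open>3 * (a - b)\<close>,
      so \<open>m * d\<close> occurs in \<open>p (m + d)\<close> with twice that; excluding the
      primes 2 and 3 keeps it nonzero modulo \<open>N\<close>.\<close>
    then have c: "\<not> int N dvd 6 * (a - b)"
      using prime_not_dvd_6[OF N] N(1) by (simp add: prime_dvd_mult_iff del: right_diff_distrib_numeral)
    have inc: "p (m + d) - p m =
        (\<alpha> * d + 3 * (b\<^sup>2 - a\<^sup>2) * d + 3 * (a - b) * d\<^sup>2) + (6 * (a - b)) * d * m" for m d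
      unfolding p_def by (simp add: power3_eq_cube power2_eq_square algebra_simps)
    \<comment> \<open>Each term of the increment has a factor \<open>d\<close>, so
      \<open>d = N\<close> gives the period.\<close>
    have "int N dvd p (m + int N) - p m" for m
      unfolding inc by (simp add: power2_eq_square)
    from norm_quadratic_gauss_sum[OF N(1) c this inc]
    have "cmod (\<Sum>n<N. chi N (p (int n))) = sqrt N" .
    then show ?thesis
      unfolding inner by (simp add: norm_mult norm_divide sqrt_divide_self_eq inverse_eq_divide)
  qed
qed

section \<open>Entries of the time-frequency matrices acting on the Alltop sequence\<close>

lemma index_finsum_mat:
  fixes f :: "'b \<Rightarrow> 'a::comm_ring_1 mat"
  assumes "finite A" and "f \<in> A \<rightarrow> carrier_mat nr nc" and "k < nr" "l < nc"
  shows "(\<Oplus>\<^bsub>module_mat TYPE('a) nr nc\<^esub> i \<in> A. f i) $$ (k, l) = (\<Sum>i\<in>A. f i $$ (k, l))"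
proof -
  interpret abelian_group "module_mat TYPE('a) nr nc"
    by (rule abelian_group_mat)
  show ?thesis
    using assms(1,2)
  proof (induction A rule: finite_induct)
    case empty
    then show ?case
      using assms(3,4) by (simp add: module_mat_simps)
  next
    case (insert x A)
    then have f: "f \<in> A \<rightarrow> carrier (module_mat TYPE('a) nr nc)"
        "f x \<in> carrier (module_mat TYPE('a) nr nc)"
      by (auto simp: module_mat_simps)
    have "(\<Oplus>\<^bsub>module_mat TYPE('a) nr nc\<^esub> i \<in> A. f i) \<in> carrier_mat nr nc"
      using finsum_closed[OF f(1)] by (simp add: module_mat_simps)
    then show ?case
      using insert f assms(3,4) by (subst finsum_insert) (auto simp: module_mat_simps)
  qed
qed

lemma mat_diag_pow: "mat_diag n f ^\<^sub>m k = mat_diag n (\<lambda>i. f i ^ k :: 'a::comm_semiring_1)"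
proof (induction k)
  case 0
  show ?case
    by (simp add: mat_diag_def)
next
  case (Suc k)
  then show ?case
    by (simp add: mult.commute)
qed

lemma index_mat_diag_mult_vec:
  fixes v :: "'a::comm_semiring_1 vec"
  assumes "v \<in> carrier_vec n" "k < n"
  shows "(mat_diag n f *\<^sub>v v) $ k = f k * v $ k"
proof -
  have "(mat_diag n f *\<^sub>v v) $ k = (\<Sum>j<n. (if k = j then f j else 0) * v $ j)"
    using assms by (simp add: mat_diag_def scalar_prod_def lessThan_atLeast0)
  also have "\<dots> = (\<Sum>j<n. if k = j then f j * v $ j else 0)"
    by (rule sum.cong) auto
  finally show ?thesis
    using assms by simp
qed

lemma shift_mat_carrier [simp]: "shift_mat N \<in> carrier_mat N N"
  by (simp add: shift_mat_def)

text \<open>\<open>N - 1\<close> stands for -1 modulo \<open>N\<close>: truncated subtraction would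
  fail at \<open>k = 0\<close>, and this form iterates to \<open>b * (N - 1)\<close>.\<close>

lemma index_shift_mat_mult_vec:
  assumes "v \<in> carrier_vec N" "k < N"
  shows "(shift_mat N *\<^sub>v v) $ k = v $ ((k + (N - 1)) mod N)"
proof -
  have pre: "k = (j + 1) mod N \<longleftrightarrow> j = (k + (N - 1)) mod N" if "j < N" for j
  proof (cases "k = 0")
    case True
    then show ?thesis
      using that assms by (cases "j + 1 = N") auto
  next
    case False
    then have "(k + (N - 1)) mod N = k - 1"
      using assms by (simp add: mod_if)
    then show ?thesis
      using that assms False by (cases "j + 1 = N") auto
  qed
  have "(shift_mat N *\<^sub>v v) $ k = (\<Sum>j<N. (if k = (j + 1) mod N then 1 else 0) * v $ j)"
    using assms by (simp add: shift_mat_def scalar_prod_def lessThan_atLeast0)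
  also have "\<dots> = (\<Sum>j<N. if j = (k + (N - 1)) mod N then v $ j else 0)"
    by (rule sum.cong) (use pre in auto)
  finally show ?thesis
    using assms by simp
qed

lemma index_shift_mat_pow_mult_vec:
  assumes "v \<in> carrier_vec N" "k < N"
  shows "(shift_mat N ^\<^sub>m b *\<^sub>v v) $ k = v $ ((k + b * (N - 1)) mod N)"
  using assms
proof (induction b arbitrary: v)
  case 0
  then show ?case
    by (simp add: shift_mat_def)
next
  case (Suc b)
  let ?S = "shift_mat N"
  have Sv: "?S *\<^sub>v v \<in> carrier_vec N"
    using Suc.prems by (intro mult_mat_vec_carrier[of _ N N]) auto
  \<comment> \<open>The matrix power splits off its right factor, which acts on \<open>v\<close>
    first; hence the induction generalizes over \<open>v\<close>.\<close>
  have "?S ^\<^sub>m Suc b *\<^sub>v v = ?S ^\<^sub>m b *\<^sub>v (?S *\<^sub>v v)"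
    using Suc.prems by (simp add: assoc_mult_mat_vec[where ?n\<^sub>1.0 = N and ?n\<^sub>2.0 = N and ?n\<^sub>3.0 = N])
  then have "(?S ^\<^sub>m Suc b *\<^sub>v v) $ k = (?S *\<^sub>v v) $ ((k + b * (N - 1)) mod N)"
    using Suc.IH[OF Sv Suc.prems(2)] by simp
  also have "\<dots> = v $ (((k + b * (N - 1)) mod N + (N - 1)) mod N)"
    using Suc.prems by (intro index_shift_mat_mult_vec) auto
  also have "((k + b * (N - 1)) mod N + (N - 1)) mod N = (k + Suc b * (N - 1)) mod N"
    unfolding mod_add_left_eq by (simp add: add_ac)
  finally show ?case .
qed

lemma omega_power: "omega N ^ j = chi N (int j)"
proof -
  have "omega N = cis (2 * pi / of_nat N)"
    by (simp add: omega_def cis_conv_exp mult.commute)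
  then show ?thesis
    by (simp add: chi_def DeMoivre mult_ac)
qed

lemma index_alltop:
  "n < N \<Longrightarrow> alltop N $ n = of_real (1 / sqrt N) * chi N (int n ^ 3)"
  by (simp add: alltop_def chi_def cis_conv_exp mult_ac)

lemma alltop_carrier [simp]: "alltop N \<in> carrier_vec N"
  by (simp add: alltop_def)

lemma dim_alltop [simp]: "dim_vec (alltop N) = N"
  by (simp add: alltop_def)

lemma tf_mat_carrier [simp]: "tf_mat N i \<in> carrier_mat N N"
  unfolding tf_mat_def modulation_mat_def
  by (intro mult_carrier_mat[of _ N N]) (auto intro!: pow_carrier_mat)

lemma dim_tf_mat [simp]: "dim_row (tf_mat N i) = N" "dim_col (tf_mat N i) = N"
  using tf_mat_carrier carrier_matD by blast+

lemma tf_mat_mult_alltop: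
  assumes "n < N"
  shows "(tf_mat N i *\<^sub>v alltop N) $ n = atom N i n"
proof -
  let ?b = "i div N" and ?S = "shift_mat N ^\<^sub>m (i div N)"
  let ?D = "mat_diag N (\<lambda>j. (omega N ^ j) ^ (i mod N))"
  have S: "?S \<in> carrier_mat N N"
    by (intro pow_carrier_mat) simp
  have "tf_mat N i *\<^sub>v alltop N = ?D *\<^sub>v (?S *\<^sub>v alltop N)"
    using S by (simp add: tf_mat_def modulation_mat_def mat_diag_pow
        assoc_mult_mat_vec[where ?n\<^sub>1.0 = N and ?n\<^sub>2.0 = N and ?n\<^sub>3.0 = N])
  also have "\<dots> $ n = (omega N ^ n) ^ (i mod N) * (?S *\<^sub>v alltop N) $ n"
    using S assms by (intro index_mat_diag_mult_vec mult_mat_vec_carrier[of _ N N]) auto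
  also have "(omega N ^ n) ^ (i mod N) = chi N (int (i mod N) * int n)"
    by (simp add: omega_power chi_power)
  also have "(?S *\<^sub>v alltop N) $ n = alltop N $ ((n + ?b * (N - 1)) mod N)"
    using assms by (intro index_shift_mat_pow_mult_vec) auto
  also have "\<dots> = of_real (1 / sqrt N) * chi N (int ((n + ?b * (N - 1)) mod N) ^ 3)"
    using assms by (intro index_alltop) auto
  \<comment> \<open>The reduced index and the integer \<open>n - i div N\<close> agree modulo
    \<open>N\<close>, hence so do their cubes, and \<open>chi\<close> sees only residues.\<close>
  also have "chi N (int ((n + ?b * (N - 1)) mod N) ^ 3) = chi N ((int n - int ?b) ^ 3)"
  proof (rule chi_cong)
    have "(int n + int ?b * (int N - 1)) mod int N = (int n - int ?b) mod int N"
      by (simp add: mod_eq_dvd_iff algebra_simps)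
    then have "int ((n + ?b * (N - 1)) mod N) mod int N = (int n - int ?b) mod int N"
      using assms by (simp add: zmod_int)
    then have "int ((n + ?b * (N - 1)) mod N) ^ 3 mod int N = (int n - int ?b) ^ 3 mod int N"
      by (metis power_mod)
    then show "int N dvd int ((n + ?b * (N - 1)) mod N) ^ 3 - (int n - int ?b) ^ 3"
      by (simp add: mod_eq_dvd_iff)
  qed (use assms in simp)
  finally show ?thesis
    by (simp add: atom_def chi_add)
qed

lemma dim_dictionary [simp]: "dim_row (dictionary N) = N" "dim_col (dictionary N) = N\<^sup>2"
  by (simp_all add: dictionary_def)

lemma index_dictionary_mult_vec:
  assumes "v \<in> carrier_vec (N\<^sup>2)" "n < N"
  shows "(dictionary N *\<^sub>v v) $ n = (\<Sum>i<N\<^sup>2. atom N i n * v $ i)"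
proof -
  have "dictionary N $$ (n, i) = atom N i n" if "i < N\<^sup>2" for i
    using that assms by (simp add: dictionary_def mat_of_cols_index tf_mat_mult_alltop
        del: index_mult_mat_vec)
  then show ?thesis
    using assms
    by (auto simp: scalar_prod_def lessThan_atLeast0 intro!: sum.cong)
qed

text \<open>This turns the observation into linear measurements of \<open>s\<close>. On entries, the
  two sides differ by exchanging the sums over matrix columns and basis elements.\<close>

lemma tf_combination_mult_alltop:
  assumes "s \<in> carrier_vec (N\<^sup>2)"
  shows "tf_combination N s *\<^sub>v alltop N = dictionary N *\<^sub>v s"
proof -
  interpret abelian_group "module_mat TYPE(complex) N N"
    by (rule abelian_group_mat)
  have C: "tf_combination N s \<in> carrier_mat N N"
    unfolding tf_combination_def
    using finsum_closed[of "\<lambda>i. s $ i \<cdot>\<^sub>m tf_mat N i" "{..<N\<^sup>2}"]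
    by (simp add: module_mat_simps)
  have entry: "tf_combination N s $$ (k, l) = (\<Sum>i<N\<^sup>2. s $ i * tf_mat N i $$ (k, l))"
    if "k < N" "l < N" for k l
    using that by (simp add: tf_combination_def index_finsum_mat)
  show ?thesis
  proof (rule eq_vecI)
    fix n assume "n < dim_vec (dictionary N *\<^sub>v s)"
    then have n: "n < N"
      by simp
    have "(tf_combination N s *\<^sub>v alltop N) $ n
        = (\<Sum>l<N. \<Sum>i<N\<^sup>2. s $ i * tf_mat N i $$ (n, l) * alltop N $ l)"
      using n carrier_matD[OF C]
      by (simp add: scalar_prod_def lessThan_atLeast0[symmetric] entry sum_distrib_right)
    also have "\<dots> = (\<Sum>i<N\<^sup>2. s $ i * (tf_mat N i *\<^sub>v alltop N) $ n)"
      using n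
      by (subst sum.swap)
        (simp add: scalar_prod_def lessThan_atLeast0[symmetric] sum_distrib_left mult.assoc)
    also have "\<dots> = (dictionary N *\<^sub>v s) $ n"
      using n assms by (simp add: tf_mat_mult_alltop index_dictionary_mult_vec mult.commute
          del: index_mult_mat_vec)
    finally show "(tf_combination N s *\<^sub>v alltop N) $ n = (dictionary N *\<^sub>v s) $ n" .
  qed (use C in simp)
qed

section \<open>Sparse recovery from coherence\<close>

text \<open>Pairing the residual with the column \<open>\<phi> i\<close> returns \<open>h i\<close>
  plus cross terms. The pairing is at most \<open>\<delta>\<close> times the 1-norm of the column,
  the cross terms at most \<open>\<mu>\<close> times the 1-norm of \<open>h\<close> off
  \<open>i\<close>; adding the missing \<open>\<mu> * cmod (h i)\<close> on both sides produces the
  factor \<open>1 + \<mu>\<close>.\<close>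

lemma entry_bound_by_coherence:
  fixes \<phi> :: "'i \<Rightarrow> 'n \<Rightarrow> complex" and h :: "'i \<Rightarrow> complex"
  assumes I: "finite I" "i \<in> I"
    and normalized: "(\<Sum>n\<in>A. cnj (\<phi> i n) * \<phi> i n) = 1"
    and coherence: "\<And>j. j \<in> I \<Longrightarrow> j \<noteq> i \<Longrightarrow> cmod (\<Sum>n\<in>A. cnj (\<phi> i n) * \<phi> j n) \<le> \<mu>"
    and residual: "\<And>n. n \<in> A \<Longrightarrow> cmod (\<Sum>j\<in>I. \<phi> j n * h j) \<le> \<delta>"
  shows "(1 + \<mu>) * cmod (h i) \<le> (\<Sum>n\<in>A. cmod (\<phi> i n)) * \<delta> + \<mu> * (\<Sum>j\<in>I. cmod (h j))"
proof -
  define G where "G j = (\<Sum>n\<in>A. cnj (\<phi> i n) * \<phi> j n)" for j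
  define R where "R = (\<Sum>n\<in>A. cnj (\<phi> i n) * (\<Sum>j\<in>I. \<phi> j n * h j))"
  define Q where "Q = (\<Sum>j\<in>I - {i}. G j * h j)"
  have "R = (\<Sum>j\<in>I. G j * h j)"
    unfolding R_def G_def
    by (simp add: sum_distrib_left sum_distrib_right mult.assoc) (rule sum.swap)
  also have "\<dots> = h i + Q"
    using I normalized by (simp add: sum.remove[of I i] G_def Q_def)
  finally have "cmod (h i) \<le> cmod R + cmod Q"
    using norm_triangle_ineq4[of R Q] by simp
  also have "cmod R \<le> (\<Sum>n\<in>A. cmod (\<phi> i n) * \<delta>)"
    unfolding R_def
    by (rule sum_norm_le) (auto simp: norm_mult intro!: mult_left_mono residual)
  also have "cmod Q \<le> (\<Sum>j\<in>I - {i}. \<mu> * cmod (h j))"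
    unfolding Q_def
    by (rule sum_norm_le) (auto simp: norm_mult G_def intro!: mult_right_mono coherence)
  also have "\<dots> = \<mu> * (\<Sum>j\<in>I. cmod (h j)) - \<mu> * cmod (h i)"
    using I by (simp add: sum.remove[of I i] sum_distrib_left distrib_left)
  finally show ?thesis
    by (simp add: sum_distrib_right[symmetric] distrib_right)
qed

text \<open>Off \<open>S\<close> the difference has the norms of \<open>t\<close>; by
  \<open>le\<close> their sum is at most the excess of \<open>s\<close> over \<open>t\<close> on
  \<open>S\<close>, which the triangle inequality bounds by the difference on
  \<open>S\<close>.\<close>

lemma l1_cone_condition:
  fixes s t :: "'i \<Rightarrow> 'a::real_normed_vector"
  assumes I: "finite I" "S \<subseteq> I" and supp: "\<And>i. i \<in> I - S \<Longrightarrow> s i = 0"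
    and le: "(\<Sum>i\<in>I. norm (t i)) \<le> (\<Sum>i\<in>I. norm (s i))"
  shows "(\<Sum>i\<in>I. norm (s i - t i)) \<le> 2 * (\<Sum>i\<in>S. norm (s i - t i))"
proof -
  have split: "(\<Sum>i\<in>I. f i) = (\<Sum>i\<in>I - S. f i) + (\<Sum>i\<in>S. f i)" for f :: "'i \<Rightarrow> real"
    using I by (simp add: sum.subset_diff)
  have out: "(\<Sum>i\<in>I - S. norm (s i)) = 0" "(\<Sum>i\<in>I - S. norm (s i - t i)) = (\<Sum>i\<in>I - S. norm (t i))"
    using supp by auto
  have "(\<Sum>i\<in>S. norm (s i)) - (\<Sum>i\<in>S. norm (t i)) \<le> (\<Sum>i\<in>S. norm (s i - t i))"
    unfolding sum_subtractf[symmetric] by (intro sum_mono norm_triangle_ineq2)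
  then show ?thesis
    using le out unfolding split by simp
qed

theorem theorem3:
  fixes N K :: nat and \<epsilon> T :: real
    and H :: "complex mat" and s e y s_star :: "complex vec"
  assumes "prime N" and "N \<ge> 5"
    and "\<epsilon> \<ge> 0" and "T > 0"
    and "s \<in> carrier_vec (N\<^sup>2)"
    and "H = tf_combination N s"
    and "sparse K s"
    and "real K < (1 / 2 * (sqrt (real N) + 1)) / (1 + 2 * \<epsilon> * real N / T)"
    and "e \<in> carrier_vec N" and "\<And>n. n < N \<Longrightarrow> cmod (e $ n) \<le> \<epsilon>"
    and "y = H *\<^sub>v alltop N + e"
    and "bp_solution (dictionary N) y \<epsilon> s_star"
  shows "l1_norm (s - s_star) \<le> T"
proof -
  let ?\<Phi> = "dictionary N" and ?I = "{..<N\<^sup>2}"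
  have dims [simp]: "dim_vec s = N\<^sup>2" "dim_vec e = N"
    using assms(5,9) by auto
  have y: "y = ?\<Phi> *\<^sub>v s + e"
    using assms(5,6,11) tf_combination_mult_alltop by simp
  have star: "bp_feasible ?\<Phi> y \<epsilon> s_star" "\<And>t. bp_feasible ?\<Phi> y \<epsilon> t \<Longrightarrow> l1_norm s_star \<le> l1_norm t"
    using assms(12) by (auto simp: bp_solution_def is_arg_min_linorder)
  have star_carrier: "s_star \<in> carrier_vec (N\<^sup>2)"
    using star(1) by (simp add: bp_feasible_def)
  then have [simp]: "dim_vec s_star = N\<^sup>2"
    by simp
  \<comment> \<open>The residual of \<open>s\<close> is \<open>- e\<close>, so the noise bound is
    exactly feasibility.\<close>
  have "bp_feasible ?\<Phi> y \<epsilon> s"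
    using assms(5,10) by (simp add: bp_feasible_def y del: index_mult_mat_vec)
  then have min: "l1_norm s_star \<le> l1_norm s"
    by (rule star(2))

  define h where "h i = s $ i - s_star $ i" for i
  define S where "S = {i. i < N\<^sup>2 \<and> s $ i \<noteq> 0}"
  define L where "L = (\<Sum>i\<in>?I. cmod (h i))"
  have L: "l1_norm (s - s_star) = L"
    by (simp add: l1_norm_def L_def h_def)
  have "L \<ge> 0"
    by (simp add: L_def sum_nonneg)
  have cone: "L \<le> 2 * (\<Sum>i\<in>S. cmod (h i))"
    unfolding L_def h_def
    by (rule l1_cone_condition) (use min in \<open>auto simp: S_def l1_norm_def\<close>)

  \<comment> \<open>Both \<open>s\<close> and \<open>s_star\<close> explain \<open>y\<close> up to
    \<open>\<epsilon>\<close>, whence the factor 2.\<close>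
  have residual: "cmod (\<Sum>j\<in>?I. atom N j n * h j) \<le> 2 * \<epsilon>" if "n < N" for n
  proof -
    have "(\<Sum>j\<in>?I. atom N j n * h j) = (?\<Phi> *\<^sub>v s) $ n - (?\<Phi> *\<^sub>v s_star) $ n"
      using that assms(5) star_carrier
      by (simp add: index_dictionary_mult_vec h_def right_diff_distrib sum_subtractf
          del: index_mult_mat_vec)
    also have "\<dots> = - (?\<Phi> *\<^sub>v s_star - y) $ n - e $ n"
      using that by (simp add: y del: index_mult_mat_vec)
    also have "cmod \<dots> \<le> cmod ((?\<Phi> *\<^sub>v s_star - y) $ n) + cmod (e $ n)"
      using norm_triangle_ineq4[of "- (?\<Phi> *\<^sub>v s_star - y) $ n" "e $ n"] by simp
    also have "\<dots> \<le> \<epsilon> + \<epsilon>"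
      using that star(1) assms(10) by (intro add_mono) (auto simp: bp_feasible_def)
    finally show ?thesis by simp
  qed
  define r where "r = sqrt (real N)"
  have r: "r > 0" "r * r = real N"
    using assms(2) by (auto simp: r_def)
  have entry: "(r + 1) * cmod (h i) \<le> 2 * \<epsilon> * N + L" if "i \<in> ?I" for i
  proof -
    have "(1 + 1 / r) * cmod (h i) \<le> (\<Sum>n\<in>{..<N}. cmod (atom N i n)) * (2 * \<epsilon>) + 1 / r * L"
      unfolding L_def r_def
      by (rule entry_bound_by_coherence)
        (use that assms(1,2) residual in \<open>auto intro!: atom_inner_self atom_coherence simp del: of_real_divide\<close>)
    \<comment> \<open>A column has \<open>N\<close> entries of modulus \<open>1 / r\<close>, so its
      1-norm is \<open>r\<close>; multiplying through by \<open>r\<close> then turns the noise term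
      into \<open>2 * \<epsilon> * N\<close>.\<close>
    also have "(\<Sum>n\<in>{..<N}. cmod (atom N i n)) = r"
      using r by (simp add: norm_atom r_def real_div_sqrt)
    finally have "r * ((1 + 1 / r) * cmod (h i)) \<le> r * (r * (2 * \<epsilon>) + 1 / r * L)"
      using r by simp
    also have "r * (r * (2 * \<epsilon>) + 1 / r * L) = (r * r) * (2 * \<epsilon>) + L"
      using r(1) by (simp add: distrib_left)
    finally show ?thesis
      using r by (simp add: algebra_simps)
  qed
  have "card S \<le> K"
    using assms(7) by (simp add: sparse_def S_def)
  have "(r + 1) / 2 * L \<le> (\<Sum>i\<in>S. (r + 1) * cmod (h i))"
    using mult_left_mono[OF cone, of "(r + 1) / 2"] r by (simp add: sum_distrib_left)
  also have "\<dots> \<le> card S * (2 * \<epsilon> * N + L)"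
    using entry by (intro sum_bounded_above) (auto simp: S_def)
  also have "\<dots> \<le> K * (2 * \<epsilon> * N + L)"
    using \<open>card S \<le> K\<close> \<open>L \<ge> 0\<close> assms(3) by (intro mult_right_mono) auto
  finally have bound: "((r + 1) / 2 - K) * L \<le> 2 * \<epsilon> * N * K"
    by (simp add: algebra_simps)
  define c where "c = 2 * \<epsilon> * N * K"
  have pos: "1 + 2 * \<epsilon> * real N / T > 0"
    using assms(3,4) by (intro add_pos_nonneg) auto
  have "K * (1 + 2 * \<epsilon> * real N / T) < (r + 1) / 2"
    using assms(8) unfolding pos_less_divide_eq[OF pos] by (simp only: r_def)
  then have gap: "c / T < (r + 1) / 2 - K"
    by (simp add: c_def algebra_simps)
  have "L \<le> T"
  proof (rule ccontr)
    assume "\<not> L \<le> T"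
    \<comment> \<open>Without noise \<open>c\<close> is zero, so \<open>L > T\<close> gives only a
      weak inequality here; strictness comes from \<open>gap\<close> and
      \<open>L > 0\<close>.\<close>
    then have "c / T * T \<le> c / T * L"
      using assms(3,4) by (intro mult_left_mono) (auto simp: c_def)
    also have "\<dots> < ((r + 1) / 2 - K) * L"
      using gap \<open>\<not> L \<le> T\<close> assms(4) by (intro mult_strict_right_mono) auto
    finally show False
      using bound assms(4) by (simp add: c_def)
  qed
  then show ?thesis
    by (simp add: L)
qed

end
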